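(* Let $\mathcal A=\langle A,T,Q,\gamma,\eta,\varepsilon\rangle$ be a skew monoidal monoid. The Eilenberg–Moore category $\mathcal A_Q$ of the comonad $\langle Q,\delta,\varepsilon\rangle$ is a strict monoidal category with respect to the vertical tensor product, defined for objects by $u\circledcirc v:=\mu T(v)u$ and for arrows $s:u_1\to v_1$, $t:u_2\to v_2$ by $s\otimes t:=s\,\varepsilon\, T(t)\,u_1$. The element $\delta\in A$ is the underlying object of a monoid $\langle\delta,\mu,\eta\rangle$ in $\mathcal A_Q$, and $\delta$ is a cogenerator in $\mathcal A_Q$. The endomorphism monoid of $\delta$ is the underlying monoid of a source-regular left $A$-bialgebroid $F$ defined by - underlying monoid: $F=\mathcal A_Q(\delta,\delta)=Q(A)\delta$; - source $s_F:A\to F$, $s_F(a)=Q(a)$; - target $t_F:A^{\mathrm{op}}\to F$, $t_F(a)=S(a)$; - comultiplication $\Delta_F:F\to F\otimes_AF$, $\Delta_F(f)=Q(\varepsilon f\mu)\delta\otimes_A\delta$; - counit $\epsilon_F:F\to A$, $\epsilon_F(f)=\varepsilon f\eta$; where in the last two lines $\Delta_F$ and $\epsilon_F$ are maps of $A$-$A$-bimodules and the $A$-bimodule structure of $F$ is $a_1\cdot f\cdot a_2:=Q(a_1)S(a_2)f$.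
   Context: A skew monoidal monoid $\mathcal A=\langle A,T,Q,\gamma,\eta,\varepsilon\rangle$ consists of a monoid $A$, monoid endomorphisms $T,Q:A\to A$ and elements $\gamma,\eta,\varepsilon\in A$ such that for all $a,b\in A$: $T(a)Q(b)=Q(b)T(a)$, $\gamma T^2(a)=T(a)\gamma$, $\gamma TQ(a)=QT(a)\gamma$, $\gamma Q(a)=Q^2(a)\gamma$, $\eta a=T(a)\eta$, $a\varepsilon=\varepsilon Q(a)$, $Q(\gamma)\gamma T(\gamma)=\gamma^2$, $\gamma\eta=Q(\eta)$, $\varepsilon\gamma=T(\varepsilon)$, $Q(\varepsilon)\gamma T(\eta)=1$, $\varepsilon\eta=1$. Put $\mu:=Q(\varepsilon)\gamma$, $\delta:=\gamma T(\eta)$ (then $\gamma=\mu\delta$) and $S:A\to A^{\mathrm{op}}$, $S(a):=\mu T(Q(a)\eta)$, a monoid morphism. The comodule category $\mathcal A_Q$ has as objects the elements $u\in A$ with $Q(u)u=\delta u$ and $\varepsilon u=1$; its arrows $s:u\to v$ are the elements $s\in A$ with $Q(s)u=vs$; composition is multiplication in $A$. The unit object for the vertical tensor product is $\eta$. A left $A$-bialgebroid (over a monoid $A$, in sets) is a monoid $F$ with monoid morphisms $s:A\to F$ (source), $t:A^{\mathrm{op}}\to F$ (target) whose images commute, together with a comonoid structure $\Delta:F\to F\otimes_AF$, $f\mapsto f_{(1)}\otimes f_{(2)}$, $\epsilon:F\to A$ in the monoidal category of $A$-$A$-bisets (bimodules), where $F$ is a bimodule by $a_1\cdot f\cdot a_2=s(a_1)t(a_2)f$,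 such that for all $a\in A$, $f,f'\in F$: $f_{(1)}t(a)\otimes f_{(2)}=f_{(1)}\otimes f_{(2)}s(a)$, $\Delta(ff')=f_{(1)}f'_{(1)}\otimes f_{(2)}f'_{(2)}$, $\Delta(1)=1\otimes1$, $\epsilon(1)=1$, $\epsilon(fs(\epsilon(f')))=\epsilon(ff')=\epsilon(ft(\epsilon(f')))$. It is source-regular if $F$, as a left $A$-module via left multiplication by $s(a)$, is isomorphic to the left regular $A$-module ${}_AA$. *)

theory Defs
  imports "HOL-Algebra.Group"
begin

text \<open>\<^const>\<open>hom\<close> does not require the unit to be preserved.\<close>

definition monoid_morphisms ::
  "('a, 'm) monoid_scheme \<Rightarrow> ('b, 'n) monoid_scheme \<Rightarrow> ('a \<Rightarrow> 'b) set" where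
  "monoid_morphisms A B = {h \<in> hom A B. h \<one>\<^bsub>A\<^esub> = \<one>\<^bsub>B\<^esub>}"

definition opposite_monoid :: "('a, 'm) monoid_scheme \<Rightarrow> 'a monoid" where
  "opposite_monoid A = \<lparr>carrier = carrier A, mult = (\<lambda>x y. y \<otimes>\<^bsub>A\<^esub> x), one = \<one>\<^bsub>A\<^esub>\<rparr>"

locale skew_monoidal_monoid = monoid A for A (structure) +
  fixes T Q :: "'a \<Rightarrow> 'a" and \<gamma> \<eta> \<epsilon> :: 'a
  assumes T_morphism: "T \<in> monoid_morphisms A A"
    and Q_morphism: "Q \<in> monoid_morphisms A A"
    and gamma_closed: "\<gamma> \<in> carrier A"
    and eta_closed: "\<eta> \<in> carrier A"
    and eps_closed: "\<epsilon> \<in> carrier A"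
    and T_Q_commute: "\<lbrakk>a \<in> carrier A; b \<in> carrier A\<rbrakk> \<Longrightarrow> T a \<otimes> Q b = Q b \<otimes> T a"
    and gamma_TT: "a \<in> carrier A \<Longrightarrow> \<gamma> \<otimes> T (T a) = T a \<otimes> \<gamma>"
    and gamma_TQ: "a \<in> carrier A \<Longrightarrow> \<gamma> \<otimes> T (Q a) = Q (T a) \<otimes> \<gamma>"
    and gamma_Q: "a \<in> carrier A \<Longrightarrow> \<gamma> \<otimes> Q a = Q (Q a) \<otimes> \<gamma>"
    and eta_nat: "a \<in> carrier A \<Longrightarrow> \<eta> \<otimes> a = T a \<otimes> \<eta>"
    and eps_nat: "a \<in> carrier A \<Longrightarrow> a \<otimes> \<epsilon> = \<epsilon> \<otimes> Q a"
    and pentagon: "Q \<gamma> \<otimes> \<gamma> \<otimes> T \<gamma> = \<gamma> \<otimes> \<gamma>"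
    and gamma_eta: "\<gamma> \<otimes> \<eta> = Q \<eta>"
    and eps_gamma: "\<epsilon> \<otimes> \<gamma> = T \<epsilon>"
    and eps_gamma_eta: "Q \<epsilon> \<otimes> \<gamma> \<otimes> T \<eta> = \<one>"
    and eps_eta: "\<epsilon> \<otimes> \<eta> = \<one>"


section \<open>Categories and strict monoidal categories\<close>

text \<open>Hom-sets of different pairs of objects may overlap, so the structure maps take the objects
  involved as arguments: \<open>Comp C u v w g f\<close> is the composite of \<open>f : u \<rightarrow> v\<close> and \<open>g : v \<rightarrow> w\<close>.\<close>

record ('o, 'm) cat =
  Obj :: "'o set"
  Hom :: "'o \<Rightarrow> 'o \<Rightarrow> 'm set"
  Comp :: "'o \<Rightarrow> 'o \<Rightarrow> 'o \<Rightarrow> 'm \<Rightarrow> 'm \<Rightarrow> 'm"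
  Ident :: "'o \<Rightarrow> 'm"

locale category =
  fixes C :: "('o, 'm) cat"
  assumes ident_in_hom: "u \<in> Obj C \<Longrightarrow> Ident C u \<in> Hom C u u"
    and comp_in_hom:
      "\<lbrakk>u \<in> Obj C; v \<in> Obj C; w \<in> Obj C; f \<in> Hom C u v; g \<in> Hom C v w\<rbrakk>
        \<Longrightarrow> Comp C u v w g f \<in> Hom C u w"
    and comp_ident: "\<lbrakk>u \<in> Obj C; v \<in> Obj C; f \<in> Hom C u v\<rbrakk> \<Longrightarrow> Comp C u u v f (Ident C u) = f"
    and ident_comp: "\<lbrakk>u \<in> Obj C; v \<in> Obj C; f \<in> Hom C u v\<rbrakk> \<Longrightarrow> Comp C u v v (Ident C v) f = f"
    and comp_assoc:
      "\<lbrakk>u \<in> Obj C; v \<in> Obj C; w \<in> Obj C; x \<in> Obj C;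
        f \<in> Hom C u v; g \<in> Hom C v w; h \<in> Hom C w x\<rbrakk>
        \<Longrightarrow> Comp C u w x h (Comp C u v w g f) = Comp C u v x (Comp C v w x h g) f"

text \<open>\<open>tenA u1 v1 u2 v2 s t\<close> is the tensor product of \<open>s : u1 \<rightarrow> v1\<close> and \<open>t : u2 \<rightarrow> v2\<close>.\<close>

locale strict_monoidal_category = category C for C :: "('o, 'm) cat" +
  fixes ten :: "'o \<Rightarrow> 'o \<Rightarrow> 'o"
    and tenA :: "'o \<Rightarrow> 'o \<Rightarrow> 'o \<Rightarrow> 'o \<Rightarrow> 'm \<Rightarrow> 'm \<Rightarrow> 'm"
    and I :: 'o
  assumes unit_obj: "I \<in> Obj C"
    and ten_obj: "\<lbrakk>u \<in> Obj C; v \<in> Obj C\<rbrakk> \<Longrightarrow> ten u v \<in> Obj C"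
    and tenA_in_hom:
      "\<lbrakk>u1 \<in> Obj C; v1 \<in> Obj C; u2 \<in> Obj C; v2 \<in> Obj C; s \<in> Hom C u1 v1; t \<in> Hom C u2 v2\<rbrakk>
        \<Longrightarrow> tenA u1 v1 u2 v2 s t \<in> Hom C (ten u1 u2) (ten v1 v2)"
    and tenA_ident:
      "\<lbrakk>u \<in> Obj C; v \<in> Obj C\<rbrakk> \<Longrightarrow> tenA u u v v (Ident C u) (Ident C v) = Ident C (ten u v)"
    and tenA_comp:
      "\<lbrakk>u1 \<in> Obj C; v1 \<in> Obj C; w1 \<in> Obj C; u2 \<in> Obj C; v2 \<in> Obj C; w2 \<in> Obj C;
        s \<in> Hom C u1 v1; s' \<in> Hom C v1 w1; t \<in> Hom C u2 v2; t' \<in> Hom C v2 w2\<rbrakk>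
        \<Longrightarrow> tenA u1 w1 u2 w2 (Comp C u1 v1 w1 s' s) (Comp C u2 v2 w2 t' t)
          = Comp C (ten u1 u2) (ten v1 v2) (ten w1 w2)
              (tenA v1 w1 v2 w2 s' t') (tenA u1 v1 u2 v2 s t)"
    and ten_assoc:
      "\<lbrakk>u \<in> Obj C; v \<in> Obj C; w \<in> Obj C\<rbrakk> \<Longrightarrow> ten (ten u v) w = ten u (ten v w)"
    and unit_ten: "u \<in> Obj C \<Longrightarrow> ten I u = u"
    and ten_unit: "u \<in> Obj C \<Longrightarrow> ten u I = u"
    and tenA_assoc:
      "\<lbrakk>u1 \<in> Obj C; v1 \<in> Obj C; u2 \<in> Obj C; v2 \<in> Obj C; u3 \<in> Obj C; v3 \<in> Obj C;
        r \<in> Hom C u1 v1; s \<in> Hom C u2 v2; t \<in> Hom C u3 v3\<rbrakk>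
        \<Longrightarrow> tenA (ten u1 u2) (ten v1 v2) u3 v3 (tenA u1 v1 u2 v2 r s) t
          = tenA u1 v1 (ten u2 u3) (ten v2 v3) r (tenA u2 v2 u3 v3 s t)"
    and unit_tenA:
      "\<lbrakk>u \<in> Obj C; v \<in> Obj C; s \<in> Hom C u v\<rbrakk> \<Longrightarrow> tenA I I u v (Ident C I) s = s"
    and tenA_unit:
      "\<lbrakk>u \<in> Obj C; v \<in> Obj C; s \<in> Hom C u v\<rbrakk> \<Longrightarrow> tenA u v I I s (Ident C I) = s"

locale monoid_object = strict_monoidal_category C ten tenA I
  for C :: "('o, 'm) cat" and ten and tenA and I +
  fixes M :: 'o and m e :: 'm
  assumes object: "M \<in> Obj C"
    and multiplication: "m \<in> Hom C (ten M M) M"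
    and unit: "e \<in> Hom C I M"
    and associativity:
      "Comp C (ten (ten M M) M) (ten M M) M m (tenA (ten M M) M M M m (Ident C M))
        = Comp C (ten M (ten M M)) (ten M M) M m (tenA M M (ten M M) M (Ident C M) m)"
    and left_unit: "Comp C (ten I M) (ten M M) M m (tenA I M M M e (Ident C M)) = Ident C M"
    and right_unit: "Comp C (ten M I) (ten M M) M m (tenA M M I M (Ident C M) e) = Ident C M"

definition cogenerator :: "('o, 'm) cat \<Rightarrow> 'o \<Rightarrow> bool" where
  "cogenerator C d \<longleftrightarrow> d \<in> Obj C \<and>
    (\<forall>u\<in>Obj C. \<forall>v\<in>Obj C. \<forall>s\<in>Hom C u v. \<forall>t\<in>Hom C u v.
      s \<noteq> t \<longrightarrow> (\<exists>f\<in>Hom C v d. Comp C u v d f s \<noteq> Comp C u v d f t))"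

definition endomorphism_monoid :: "('o, 'm) cat \<Rightarrow> 'o \<Rightarrow> 'm monoid" where
  "endomorphism_monoid C u = \<lparr>carrier = Hom C u u, mult = Comp C u u u, one = Ident C u\<rparr>"

text \<open>The Eilenberg--Moore category of a comonad \<open>\<langle>Q, \<delta>, \<epsilon>\<rangle>\<close> on the monoid \<open>A\<close>, viewed as a
  one-object category: a coalgebra is given by its structure map \<open>u \<in> A\<close>.\<close>

definition comodule_category ::
  "('a, 'm) monoid_scheme \<Rightarrow> ('a \<Rightarrow> 'a) \<Rightarrow> 'a \<Rightarrow> 'a \<Rightarrow> ('a, 'a) cat" where
  "comodule_category A Q \<delta> \<epsilon> =
    \<lparr>Obj = {u \<in> carrier A. Q u \<otimes>\<^bsub>A\<^esub> u = \<delta> \<otimes>\<^bsub>A\<^esub> u \<and> \<epsilon> \<otimes>\<^bsub>A\<^esub> u = \<one>\<^bsub>A\<^esub>},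
     Hom = (\<lambda>u v. {s \<in> carrier A. Q s \<otimes>\<^bsub>A\<^esub> u = v \<otimes>\<^bsub>A\<^esub> s}),
     Comp = (\<lambda>u v w g f. g \<otimes>\<^bsub>A\<^esub> f),
     Ident = (\<lambda>u. \<one>\<^bsub>A\<^esub>)\<rparr>"


section \<open>Bisets over a monoid\<close>

record ('a, 'x) biset =
  elts :: "'x set"
  lact :: "'a \<Rightarrow> 'x \<Rightarrow> 'x"
  ract :: "'x \<Rightarrow> 'a \<Rightarrow> 'x"

definition is_biset :: "('a, 'm) monoid_scheme \<Rightarrow> ('a, 'x) biset \<Rightarrow> bool" where
  "is_biset A X \<longleftrightarrow>
    (\<forall>a\<in>carrier A. \<forall>x\<in>elts X. lact X a x \<in> elts X \<and> ract X x a \<in> elts X) \<and>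
    (\<forall>x\<in>elts X. lact X \<one>\<^bsub>A\<^esub> x = x \<and> ract X x \<one>\<^bsub>A\<^esub> = x) \<and>
    (\<forall>a\<in>carrier A. \<forall>b\<in>carrier A. \<forall>x\<in>elts X.
      lact X (a \<otimes>\<^bsub>A\<^esub> b) x = lact X a (lact X b x) \<and>
      ract X x (a \<otimes>\<^bsub>A\<^esub> b) = ract X (ract X x a) b \<and>
      ract X (lact X a x) b = lact X a (ract X x b))"

definition biset_hom ::
  "('a, 'm) monoid_scheme \<Rightarrow> ('a, 'x) biset \<Rightarrow> ('a, 'y) biset \<Rightarrow> ('x \<Rightarrow> 'y) set" where
  "biset_hom A X Y = {h. h \<in> elts X \<rightarrow> elts Y \<and>
    (\<forall>a\<in>carrier A. \<forall>x\<in>elts X.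
      h (lact X a x) = lact Y a (h x) \<and> h (ract X x a) = ract Y (h x) a)}"

definition regular_biset :: "('a, 'm) monoid_scheme \<Rightarrow> ('a, 'a) biset" where
  "regular_biset A = \<lparr>elts = carrier A, lact = mult A, ract = mult A\<rparr>"

text \<open>The tensor product over \<open>A\<close> is the quotient of the cartesian product by the equivalence
  relation generated by \<open>(x \<cdot> a, y) \<sim> (x, a \<cdot> y)\<close>; its elements are equivalence classes,
  and \<open>tensor_elt A X Y x y\<close> is the class \<open>x \<otimes> y\<close>.\<close>

definition balancing ::
  "('a, 'm) monoid_scheme \<Rightarrow> ('a, 'x) biset \<Rightarrow> ('a, 'y) biset \<Rightarrow> (('x \<times> 'y) \<times> ('x \<times> 'y)) set" where
  "balancing A X Y =
    {((ract X x a, y), (x, lact Y a y)) | x a y. x \<in> elts X \<and> a \<in> carrier A \<and> y \<in> elts Y}"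

definition tensor_elt ::
  "('a, 'm) monoid_scheme \<Rightarrow> ('a, 'x) biset \<Rightarrow> ('a, 'y) biset \<Rightarrow> 'x \<Rightarrow> 'y \<Rightarrow> ('x \<times> 'y) set" where
  "tensor_elt A X Y x y = (balancing A X Y \<union> (balancing A X Y)\<inverse>)\<^sup>* `` {(x, y)}"

definition tensor_biset ::
  "('a, 'm) monoid_scheme \<Rightarrow> ('a, 'x) biset \<Rightarrow> ('a, 'y) biset \<Rightarrow> ('a, ('x \<times> 'y) set) biset" where
  "tensor_biset A X Y =
    \<lparr>elts = {tensor_elt A X Y x y | x y. x \<in> elts X \<and> y \<in> elts Y},
     lact = (\<lambda>a c. \<Union>(x, y)\<in>c. tensor_elt A X Y (lact X a x) y),
     ract = (\<lambda>c a. \<Union>(x, y)\<in>c. tensor_elt A X Y x (ract Y y a))\<rparr>"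

text \<open>Sweedler notation is rendered by quantifying over all representatives \<open>(x, y)\<close> of the
  class \<open>\<Delta> f\<close>; in coassociativity the associator has been applied to the left-hand side.\<close>

definition biset_comonoid ::
  "('a, 'm) monoid_scheme \<Rightarrow> ('a, 'x) biset \<Rightarrow> ('x \<Rightarrow> ('x \<times> 'x) set) \<Rightarrow> ('x \<Rightarrow> 'a) \<Rightarrow> bool" where
  "biset_comonoid A X \<Delta> e \<longleftrightarrow>
    is_biset A X \<and>
    \<Delta> \<in> biset_hom A X (tensor_biset A X X) \<and>
    e \<in> biset_hom A X (regular_biset A) \<and>
    (\<forall>f\<in>elts X. \<forall>(x, y)\<in>\<Delta> f. \<forall>(x1, x2)\<in>\<Delta> x.
      tensor_elt A X (tensor_biset A X X) x1 (tensor_elt A X X x2 y)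
        = tensor_elt A X (tensor_biset A X X) x (\<Delta> y)) \<and>
    (\<forall>f\<in>elts X. \<forall>(x, y)\<in>\<Delta> f. lact X (e x) y = f \<and> ract X x (e y) = f)"


section \<open>Left bialgebroids\<close>

definition bialgebroid_biset ::
  "('f, 'n) monoid_scheme \<Rightarrow> ('a \<Rightarrow> 'f) \<Rightarrow> ('a \<Rightarrow> 'f) \<Rightarrow> ('a, 'f) biset" where
  "bialgebroid_biset F s t =
    \<lparr>elts = carrier F, lact = (\<lambda>a f. s a \<otimes>\<^bsub>F\<^esub> f), ract = (\<lambda>f a. t a \<otimes>\<^bsub>F\<^esub> f)\<rparr>"

locale left_bialgebroid = A: monoid A + F: monoid F
  for A :: "('a, 'm) monoid_scheme" and F :: "('f, 'n) monoid_scheme" +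
  fixes s t :: "'a \<Rightarrow> 'f" and \<Delta> :: "'f \<Rightarrow> ('f \<times> 'f) set" and e :: "'f \<Rightarrow> 'a"
  assumes source: "s \<in> monoid_morphisms A F"
    and target: "t \<in> monoid_morphisms (opposite_monoid A) F"
    and source_target_commute:
      "\<lbrakk>a \<in> carrier A; b \<in> carrier A\<rbrakk> \<Longrightarrow> s a \<otimes>\<^bsub>F\<^esub> t b = t b \<otimes>\<^bsub>F\<^esub> s a"
    and comonoid: "biset_comonoid A (bialgebroid_biset F s t) \<Delta> e"
    and takeuchi:
      "\<lbrakk>a \<in> carrier A; f \<in> carrier F; (x, y) \<in> \<Delta> f\<rbrakk> \<Longrightarrow>
        tensor_elt A (bialgebroid_biset F s t) (bialgebroid_biset F s t) (x \<otimes>\<^bsub>F\<^esub> t a) y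
          = tensor_elt A (bialgebroid_biset F s t) (bialgebroid_biset F s t) x (y \<otimes>\<^bsub>F\<^esub> s a)"
    and comult_mult:
      "\<lbrakk>f \<in> carrier F; f' \<in> carrier F; (x, y) \<in> \<Delta> f; (x', y') \<in> \<Delta> f'\<rbrakk> \<Longrightarrow>
        \<Delta> (f \<otimes>\<^bsub>F\<^esub> f') = tensor_elt A (bialgebroid_biset F s t) (bialgebroid_biset F s t)
          (x \<otimes>\<^bsub>F\<^esub> x') (y \<otimes>\<^bsub>F\<^esub> y')"
    and comult_one:
      "\<Delta> \<one>\<^bsub>F\<^esub> = tensor_elt A (bialgebroid_biset F s t) (bialgebroid_biset F s t) \<one>\<^bsub>F\<^esub> \<one>\<^bsub>F\<^esub>"
    and counit_one: "e \<one>\<^bsub>F\<^esub> = \<one>\<^bsub>A\<^esub>"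
    and counit_source:
      "\<lbrakk>f \<in> carrier F; f' \<in> carrier F\<rbrakk> \<Longrightarrow> e (f \<otimes>\<^bsub>F\<^esub> s (e f')) = e (f \<otimes>\<^bsub>F\<^esub> f')"
    and counit_target:
      "\<lbrakk>f \<in> carrier F; f' \<in> carrier F\<rbrakk> \<Longrightarrow> e (f \<otimes>\<^bsub>F\<^esub> t (e f')) = e (f \<otimes>\<^bsub>F\<^esub> f')"

text \<open>\<open>F\<close> is isomorphic to the left regular \<open>A\<close>-module via left multiplication by \<open>s a\<close>.\<close>

definition source_regular ::
  "('a, 'm) monoid_scheme \<Rightarrow> ('f, 'n) monoid_scheme \<Rightarrow> ('a \<Rightarrow> 'f) \<Rightarrow> bool" where
  "source_regular A F s \<longleftrightarrow>
    (\<exists>\<phi>. bij_betw \<phi> (carrier A) (carrier F) \<and>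
      (\<forall>a\<in>carrier A. \<forall>b\<in>carrier A. \<phi> (a \<otimes>\<^bsub>A\<^esub> b) = s a \<otimes>\<^bsub>F\<^esub> \<phi> b))"

end

(* With a \<mapsto> Q a \<otimes> \<delta> the monoid F = Hom(\<delta>, \<delta>) becomes a copy of A on which A acts from the left by
   multiplication and from the right by a \<cdot> b = a \<otimes> T b.  The tensor square of F over A is then again
   A, through a \<otimes> c \<mapsto> a \<otimes> T c, the comultiplication is a \<mapsto> a \<otimes> \<mu> and the counit is a \<mapsto> a \<otimes> \<eta>, so the
   comonoid laws reduce to the monad laws of (T, \<mu>, \<eta>).  The tensor product of arrows is functorial
   because u \<otimes> \<epsilon> \<otimes> T a \<otimes> u = T a \<otimes> u for every object u. *)

theory Submission
  imports Defs
begin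

text \<open>Lifts a rule for a two-factor product to right-nested products with a further factor
  \<open>w\<close>. Applied through \<open>THEN\<close>, it lets the rule fire in the middle of a
  product normalised by \<open>m_assoc\<close>.\<close>

lemma (in monoid) mult_eq_assoc:
  assumes "x \<otimes> y = z" "x \<in> carrier G" "y \<in> carrier G" "w \<in> carrier G"
  shows "x \<otimes> (y \<otimes> w) = z \<otimes> w"
  using assms m_assoc by metis

section \<open>The monad on \<open>T\<close>, the comonad on \<open>Q\<close> and their mixed
  laws\<close>

context skew_monoidal_monoid
begin

definition mu ("\<mu>") where "\<mu> = Q \<epsilon> \<otimes> \<gamma>"
definition delta ("\<delta>") where "\<delta> = \<gamma> \<otimes> T \<eta>"
text \<open>The map \<open>S\<close> of the theorem.\<close>

definition target where "target a = \<mu> \<otimes> T (Q a \<otimes> \<eta>)"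

lemma T_closed [simp]: "a \<in> carrier A \<Longrightarrow> T a \<in> carrier A"
  and T_mult [simp]: "\<lbrakk>a \<in> carrier A; b \<in> carrier A\<rbrakk> \<Longrightarrow> T (a \<otimes> b) = T a \<otimes> T b"
  and T_one [simp]: "T \<one> = \<one>"
  using T_morphism by (auto simp: monoid_morphisms_def hom_def)

lemma Q_closed [simp]: "a \<in> carrier A \<Longrightarrow> Q a \<in> carrier A"
  and Q_mult [simp]: "\<lbrakk>a \<in> carrier A; b \<in> carrier A\<rbrakk> \<Longrightarrow> Q (a \<otimes> b) = Q a \<otimes> Q b"
  and Q_one [simp]: "Q \<one> = \<one>"
  using Q_morphism by (auto simp: monoid_morphisms_def hom_def)

lemmas [simp] = gamma_closed eta_closed eps_closed

lemma mu_closed [simp]: "\<mu> \<in> carrier A" and delta_closed [simp]: "\<delta> \<in> carrier A"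
  by (simp_all add: mu_def delta_def)

lemma target_closed [simp]: "a \<in> carrier A \<Longrightarrow> target a \<in> carrier A"
  by (simp add: target_def)

lemma Q_eps_nat: "a \<in> carrier A \<Longrightarrow> Q \<epsilon> \<otimes> Q (Q a) = Q a \<otimes> Q \<epsilon>"
  by (metis eps_nat Q_mult eps_closed Q_closed)

lemma T_eta_nat: "a \<in> carrier A \<Longrightarrow> T (T a) \<otimes> T \<eta> = T \<eta> \<otimes> T a"
  by (metis eta_nat T_mult eta_closed T_closed)

text \<open>Oriented as a rewriting system: images of \<open>Q\<close> go left of images of
  \<open>T\<close>, \<gamma> and \<epsilon> travel to the right, \<eta> travels to the left.\<close>

lemmas basic_slides = T_Q_commute gamma_TT gamma_TQ gamma_Q eta_nat[symmetric] eps_nat[symmetric]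
  Q_eps_nat T_eta_nat
lemmas basic_rules = m_assoc basic_slides basic_slides[THEN mult_eq_assoc]

lemmas eps_gamma_assoc = eps_gamma[THEN mult_eq_assoc]

lemma gamma_gamma: "\<gamma> \<otimes> \<gamma> = Q \<gamma> \<otimes> (\<gamma> \<otimes> T \<gamma>)"
  by (simp add: pentagon[symmetric] m_assoc)

lemma mu_TT: "a \<in> carrier A \<Longrightarrow> \<mu> \<otimes> T (T a) = T a \<otimes> \<mu>"
  by (simp add: mu_def basic_rules)

lemma mu_Q: "a \<in> carrier A \<Longrightarrow> \<mu> \<otimes> Q a = Q a \<otimes> \<mu>"
  by (simp add: mu_def basic_rules)

lemma mu_TQ: "a \<in> carrier A \<Longrightarrow> \<mu> \<otimes> T (Q a) = Q \<epsilon> \<otimes> (Q (T a) \<otimes> \<gamma>)"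
  by (simp add: mu_def basic_rules)

lemma delta_T: "a \<in> carrier A \<Longrightarrow> \<delta> \<otimes> T a = T a \<otimes> \<delta>"
  by (simp add: delta_def m_assoc T_eta_nat[symmetric] gamma_TT[THEN mult_eq_assoc])

lemma delta_Q: "a \<in> carrier A \<Longrightarrow> \<delta> \<otimes> Q a = Q (Q a) \<otimes> \<delta>"
  by (simp add: delta_def basic_rules)

text \<open>By \<open>gamma_eta\<close> the product collapses to
  \<open>Q (\<epsilon> \<otimes> \<eta>)\<close>. With \<open>mu_T_eta\<close> these are the unit
  laws of the monad.\<close>

lemma mu_eta: "\<mu> \<otimes> \<eta> = \<one>"
  by (metis Q_mult Q_one eps_eta eps_closed eta_closed gamma_closed gamma_eta
      m_assoc mu_def Q_closed)

lemma mu_T_eta: "\<mu> \<otimes> T \<eta> = \<one>"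
  by (simp add: mu_def eps_gamma_eta)

lemma eps_delta: "\<epsilon> \<otimes> \<delta> = \<one>"
  by (metis T_mult T_one T_closed delta_def eps_closed eps_eta eps_gamma eta_closed
      gamma_closed m_assoc)

lemma Q_eps_delta: "Q \<epsilon> \<otimes> \<delta> = \<one>"
  using eps_gamma_eta by (simp add: delta_def m_assoc)

lemma eps_mu: "\<epsilon> \<otimes> \<mu> = \<epsilon> \<otimes> T \<epsilon>"
  by (simp add: mu_def basic_rules eps_gamma)

lemma mu_T_mu: "\<mu> \<otimes> T \<mu> = \<mu> \<otimes> \<mu>"
proof -
  have "\<mu> \<otimes> T \<mu> = Q (\<epsilon> \<otimes> T \<epsilon>) \<otimes> (\<gamma> \<otimes> T \<gamma>)"
    by (simp add: mu_def basic_rules)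
  also have "\<epsilon> \<otimes> T \<epsilon> = \<epsilon> \<otimes> (Q \<epsilon> \<otimes> \<gamma>)"
    by (simp add: basic_rules eps_gamma)
  also have "Q (\<epsilon> \<otimes> (Q \<epsilon> \<otimes> \<gamma>)) \<otimes> (\<gamma> \<otimes> T \<gamma>) = \<mu> \<otimes> \<mu>"
    by (simp add: mu_def basic_rules gamma_gamma)
  finally show ?thesis .
qed

text \<open>The pentagon expands the two adjacent factors \<gamma>; then \<epsilon> absorbs the
  leftmost factor by \<open>eps_gamma\<close>, \<eta> the rightmost by \<open>gamma_eta\<close>, and
  what is left cancels by \<open>eps_eta\<close>.\<close>

lemma mu_delta: "\<mu> \<otimes> \<delta> = \<gamma>"
proof -
  have "\<mu> \<otimes> \<delta> = Q (\<epsilon> \<otimes> \<gamma>) \<otimes> (\<gamma> \<otimes> T (\<gamma> \<otimes> \<eta>))"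
    by (simp add: mu_def delta_def m_assoc gamma_gamma[THEN mult_eq_assoc])
  also have "\<dots> = \<gamma> \<otimes> T (Q (\<epsilon> \<otimes> \<eta>))"
    unfolding eps_gamma gamma_eta Q_mult[OF eps_closed eta_closed]
    by (simp add: basic_rules)
  finally show ?thesis
    by (simp add: eps_eta)
qed

lemma Q_eta_eta: "Q \<eta> \<otimes> \<eta> = \<delta> \<otimes> \<eta>"
  by (simp add: gamma_eta[symmetric] delta_def m_assoc eta_nat)

text \<open>Coassociativity of the comonad: writing \<open>Q \<eta>\<close> as
  \<open>\<gamma> \<otimes> \<eta>\<close> under \<open>T\<close> completes
  \<open>Q \<gamma> \<otimes> \<gamma>\<close> to the pentagon.\<close>

lemma Q_delta_delta: "Q \<delta> \<otimes> \<delta> = \<delta> \<otimes> \<delta>"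
proof -
  have "Q \<delta> \<otimes> \<delta> = Q \<gamma> \<otimes> (\<gamma> \<otimes> T (Q \<eta> \<otimes> \<eta>))"
    by (simp add: delta_def basic_rules)
  also have "\<dots> = (\<gamma> \<otimes> \<gamma>) \<otimes> T (T \<eta> \<otimes> \<eta>)"
    unfolding eta_nat[OF eta_closed, symmetric]
    unfolding gamma_eta[symmetric] gamma_gamma by (simp add: m_assoc)
  also have "\<dots> = \<delta> \<otimes> \<delta>"
    by (simp add: delta_def m_assoc gamma_TT[OF eta_closed, symmetric, THEN mult_eq_assoc])
  finally show ?thesis .
qed

text \<open>The pentagon with \<open>Q (Q \<epsilon>)\<close> in front and
  \<open>T (T \<eta>)\<close> behind. This mixed law is the key to closure of objects under the
  tensor product, to \<mu> being an arrow, to the target landing in \<open>\<F>\<close> and to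
  multiplicativity of the comultiplication.\<close>

lemma Q_mu_gamma_T_delta: "Q \<mu> \<otimes> (\<gamma> \<otimes> T \<delta>) = \<delta> \<otimes> \<mu>"
proof -
  have "Q \<mu> \<otimes> (\<gamma> \<otimes> T \<delta>) = Q (Q \<epsilon>) \<otimes> (\<gamma> \<otimes> \<gamma>) \<otimes> T (T \<eta>)"
    by (simp add: mu_def delta_def m_assoc gamma_gamma)
  also have "\<dots> = \<delta> \<otimes> \<mu>"
    by (simp add: mu_def delta_def basic_rules)
  finally show ?thesis .
qed

lemma mu_T_delta_arrow: "a \<in> carrier A \<Longrightarrow> \<mu> \<otimes> (T a \<otimes> \<delta>) = \<gamma> \<otimes> T a"
  by (metis T_closed delta_T delta_closed m_assoc mu_closed mu_delta)

lemmas cancels = mu_eta mu_T_eta eps_delta Q_eps_delta eps_eta mu_delta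
lemmas slides = basic_slides mu_TT mu_Q delta_T delta_Q
lemmas rules = m_assoc slides slides[THEN mult_eq_assoc] cancels cancels[THEN mult_eq_assoc]
  mu_T_delta_arrow

section \<open>The comodule category\<close>

abbreviation "\<C> \<equiv> comodule_category A Q \<delta> \<epsilon>"

abbreviation obj_ten where "obj_ten u v \<equiv> \<mu> \<otimes> T v \<otimes> u"
abbreviation arr_ten :: "'a \<Rightarrow> 'a \<Rightarrow> 'a \<Rightarrow> 'a \<Rightarrow> 'a \<Rightarrow> 'a \<Rightarrow> 'a"
  where "arr_ten u1 v1 u2 v2 s t \<equiv> s \<otimes> \<epsilon> \<otimes> T t \<otimes> u1"

lemma Obj_iff: "u \<in> Obj \<C> \<longleftrightarrow> u \<in> carrier A \<and> Q u \<otimes> u = \<delta> \<otimes> u \<and> \<epsilon> \<otimes> u = \<one>"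
  and Hom_iff: "s \<in> Hom \<C> u v \<longleftrightarrow> s \<in> carrier A \<and> Q s \<otimes> u = v \<otimes> s"
  and Comp_eq [simp]: "Comp \<C> u v w g f = g \<otimes> f"
  and Ident_eq [simp]: "Ident \<C> u = \<one>"
  by (simp_all add: comodule_category_def)

text \<open>Moving \<open>u\<close> through \<epsilon> and past \<open>T a\<close> creates
  \<open>Q u \<otimes> u\<close>; the comodule law makes this \<open>\<delta> \<otimes> u\<close>,
  and \<delta> commutes with \<open>T a\<close> and is cancelled by \<epsilon>.\<close>

lemma object_coaction_T:
  assumes "u \<in> Obj \<C>" "a \<in> carrier A"
  shows "u \<otimes> (\<epsilon> \<otimes> (T a \<otimes> u)) = T a \<otimes> u"
proof -
  have u: "u \<in> carrier A" "Q u \<otimes> u = \<delta> \<otimes> u"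
    using assms by (auto simp: Obj_iff)
  have "u \<otimes> (\<epsilon> \<otimes> (T a \<otimes> u)) = \<epsilon> \<otimes> (T a \<otimes> (Q u \<otimes> u))"
    using u(1) assms(2) by (simp add: rules)
  also have "\<dots> = \<epsilon> \<otimes> (\<delta> \<otimes> (T a \<otimes> u))"
    using u assms(2) delta_T[THEN mult_eq_assoc, of a u] by (simp add: m_assoc)
  finally show ?thesis
    using u(1) assms(2) eps_delta[THEN mult_eq_assoc, of "T a \<otimes> u"] by simp
qed

text \<open>The same argument as for \<open>object_coaction_T\<close>, with \<mu> in place of
  \<epsilon>, so that \<open>mu_delta\<close> replaces the counit law.\<close>

lemma object_coaction_mu:
  assumes "u \<in> Obj \<C>" "a \<in> carrier A"
  shows "Q u \<otimes> (\<mu> \<otimes> (T a \<otimes> u)) = \<gamma> \<otimes> (T a \<otimes> u)"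
proof -
  have u: "u \<in> carrier A" "Q u \<otimes> u = \<delta> \<otimes> u"
    using assms by (auto simp: Obj_iff)
  have "Q u \<otimes> (\<mu> \<otimes> (T a \<otimes> u)) = \<mu> \<otimes> (T a \<otimes> (Q u \<otimes> u))"
    using u(1) assms(2) by (simp add: rules)
  also have "\<dots> = (\<mu> \<otimes> (T a \<otimes> \<delta>)) \<otimes> u"
    unfolding u(2) using u(1) assms(2) by (simp add: m_assoc)
  finally show ?thesis
    using u(1) assms(2) by (simp add: mu_T_delta_arrow m_assoc)
qed


lemma category_comodule: "category \<C>"
proof
  fix u v w f g
  assume "u \<in> Obj \<C>" "v \<in> Obj \<C>" "w \<in> Obj \<C>" "f \<in> Hom \<C> u v" "g \<in> Hom \<C> v w"
  then show "Comp \<C> u v w g f \<in> Hom \<C> u w"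
    unfolding Obj_iff Hom_iff Comp_eq by (metis m_assoc m_closed Q_closed Q_mult)
qed (auto simp: Obj_iff Hom_iff m_assoc)

lemma object_eta: "\<eta> \<in> Obj \<C>" and object_delta: "\<delta> \<in> Obj \<C>"
  by (simp_all add: Obj_iff Q_eta_eta Q_delta_delta cancels)

section \<open>The vertical tensor product\<close>

lemma object_ten:
  assumes u: "u \<in> Obj \<C>" and v: "v \<in> Obj \<C>"
  shows "obj_ten u v \<in> Obj \<C>"
proof -
  have car: "u \<in> carrier A" "v \<in> carrier A" and Qv: "Q v \<otimes> v = \<delta> \<otimes> v" and e: "\<epsilon> \<otimes> u = \<one>" "\<epsilon> \<otimes> v = \<one>"
    using assms by (auto simp: Obj_iff)
  have "Q (obj_ten u v) \<otimes> obj_ten u v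
      = Q \<mu> \<otimes> (Q (T v) \<otimes> (Q u \<otimes> (\<mu> \<otimes> (T v \<otimes> u))))"
    using car by (simp add: m_assoc)
  \<comment> \<open>Through \<gamma> the factor \<open>Q (T v)\<close> becomes
    \<open>T (Q v)\<close> next to \<open>T v\<close>, ready for the comodule law of
    \<open>v\<close>.\<close>
  also have "\<dots> = Q \<mu> \<otimes> (\<gamma> \<otimes> (T (Q v \<otimes> v) \<otimes> u))"
    unfolding object_coaction_mu[OF u car(2)] using car by (simp add: rules)
  also have "\<dots> = (Q \<mu> \<otimes> (\<gamma> \<otimes> T \<delta>)) \<otimes> (T v \<otimes> u)"
    unfolding Qv using car by (simp add: m_assoc)
  also have "\<dots> = \<delta> \<otimes> obj_ten u v"
    unfolding Q_mu_gamma_T_delta using car by (simp add: m_assoc)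
  finally have "Q (obj_ten u v) \<otimes> obj_ten u v = \<delta> \<otimes> obj_ten u v" .
  moreover have "\<epsilon> \<otimes> obj_ten u v = \<epsilon> \<otimes> T (\<epsilon> \<otimes> v) \<otimes> u"
    using car by (simp add: m_assoc eps_mu[THEN mult_eq_assoc])
  then have "\<epsilon> \<otimes> obj_ten u v = \<one>"
    unfolding e(2) using e(1) by simp
  ultimately show ?thesis
    using car unfolding Obj_iff by simp
qed

lemma arr_ten_closed:
  assumes u1: "u1 \<in> Obj \<C>" and "v1 \<in> Obj \<C>" "u2 \<in> Obj \<C>" "v2 \<in> Obj \<C>"
    and s: "s \<in> Hom \<C> u1 v1" and t: "t \<in> Hom \<C> u2 v2"
  shows "arr_ten u1 v1 u2 v2 s t \<in> Hom \<C> (obj_ten u1 u2) (obj_ten v1 v2)"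
proof -
  have car: "u1 \<in> carrier A" "v1 \<in> carrier A" "u2 \<in> carrier A" "v2 \<in> carrier A"
      "s \<in> carrier A" "t \<in> carrier A"
    and Qs: "Q s \<otimes> u1 = v1 \<otimes> s" and Qt: "Q t \<otimes> u2 = v2 \<otimes> t"
    using assms by (auto simp: Obj_iff Hom_iff)
  have "Q (arr_ten u1 v1 u2 v2 s t) \<otimes> obj_ten u1 u2
      = Q s \<otimes> (Q \<epsilon> \<otimes> (Q (T t) \<otimes> (Q u1 \<otimes> (\<mu> \<otimes> (T u2 \<otimes> u1)))))"
    using car by (simp add: m_assoc)
  also have "\<dots> = Q s \<otimes> (\<mu> \<otimes> (T (Q t \<otimes> u2) \<otimes> u1))"
    unfolding object_coaction_mu[OF u1 car(3)] using car
    by (simp add: m_assoc mu_TQ[THEN mult_eq_assoc] gamma_TQ[THEN mult_eq_assoc])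
  \<comment> \<open>After the arrow law of \<open>t\<close>, \<open>object_coaction_T\<close> is
    read backwards: the inserted \<open>u1\<close> is what \<open>Q s\<close> needs for its own
    arrow law.\<close>
  also have "\<dots> = \<mu> \<otimes> (T v2 \<otimes> ((Q s \<otimes> (u1 \<otimes> (\<epsilon> \<otimes> (T t \<otimes> u1))))))"
    unfolding Qt object_coaction_T[OF u1 car(6)] using car by (simp add: rules)
  also have "\<dots> = \<mu> \<otimes> (T v2 \<otimes> ((Q s \<otimes> u1) \<otimes> (\<epsilon> \<otimes> (T t \<otimes> u1))))"
    using car by (simp add: m_assoc)
  also have "\<dots> = obj_ten v1 v2 \<otimes> arr_ten u1 v1 u2 v2 s t"
    unfolding Qs using car by (simp add: m_assoc)
  finally show ?thesis
    using car unfolding Hom_iff by simp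
qed

text \<open>The arrow law turns the middle \<open>v1 \<otimes> s\<close> into
  \<open>Q s \<otimes> u1\<close>; the factor \<open>u1\<close> is absorbed by
  \<open>object_coaction_T\<close>, and \<open>Q s\<close> leaves through \<epsilon> as
  \<open>s\<close>.\<close>

lemma arr_ten_comp:
  assumes u1: "u1 \<in> Obj \<C>" and "v1 \<in> carrier A" "s' \<in> carrier A" "t \<in> carrier A" "t' \<in> carrier A"
    and s: "s \<in> Hom \<C> u1 v1"
  shows "arr_ten u1 w1 u2 w2 (s' \<otimes> s) (t' \<otimes> t)
    = arr_ten v1 w1 v2 w2 s' t' \<otimes> arr_ten u1 v1 u2 v2 s t"
proof -
  have car: "u1 \<in> carrier A" "s \<in> carrier A" and Qs: "Q s \<otimes> u1 = v1 \<otimes> s"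
    using assms by (auto simp: Obj_iff Hom_iff)
  have "arr_ten v1 w1 v2 w2 s' t' \<otimes> arr_ten u1 v1 u2 v2 s t
      = s' \<otimes> (\<epsilon> \<otimes> (T t' \<otimes> ((v1 \<otimes> s) \<otimes> (\<epsilon> \<otimes> (T t \<otimes> u1)))))"
    using car assms by (simp add: m_assoc)
  also have "\<dots> = s' \<otimes> (\<epsilon> \<otimes> (T t' \<otimes> (Q s \<otimes> (u1 \<otimes> (\<epsilon> \<otimes> (T t \<otimes> u1))))))"
    unfolding Qs[symmetric] using car assms by (simp add: m_assoc)
  also have "\<dots> = arr_ten u1 w1 u2 w2 (s' \<otimes> s) (t' \<otimes> t)"
    unfolding object_coaction_T[OF u1 \<open>t \<in> carrier A\<close>] using car assms by (simp add: rules)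
  finally show ?thesis ..
qed

lemma arr_ten_assoc:
  assumes u1: "u1 \<in> Obj \<C>" and car: "u2 \<in> carrier A" "r \<in> carrier A" "s \<in> carrier A" "t \<in> carrier A"
  shows "arr_ten (obj_ten u1 u2) x u3 v3 (arr_ten u1 v1 u2 v2 r s) t
    = arr_ten u1 v1 y z r (arr_ten u2 v2 u3 v3 s t)"
proof -
  have u: "u1 \<in> carrier A"
    using u1 by (simp add: Obj_iff)
  \<comment> \<open>This is what remains of the claim once the common prefix
    \<open>r \<otimes> \<epsilon> \<otimes> T s\<close> is removed.\<close>
  have "u1 \<otimes> (\<epsilon> \<otimes> (T t \<otimes> (\<mu> \<otimes> (T u2 \<otimes> u1))))
      = \<epsilon> \<otimes> (Q u1 \<otimes> (\<mu> \<otimes> (T (T t \<otimes> u2) \<otimes> u1)))"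
    using u car by (simp add: m_assoc mu_TT[THEN mult_eq_assoc] eps_nat[THEN mult_eq_assoc])
  also have "\<dots> = T (\<epsilon> \<otimes> (T t \<otimes> u2)) \<otimes> u1"
    using u car by (simp del: T_mult add: object_coaction_mu[OF u1])
      (simp add: m_assoc eps_gamma_assoc)
  finally show ?thesis
    using u car by (simp add: m_assoc)
qed

lemma strict_monoidal: "strict_monoidal_category \<C> obj_ten arr_ten \<eta>"
proof (intro strict_monoidal_category.intro strict_monoidal_category_axioms.intro category_comodule)
  fix u v w
  assume "u \<in> Obj \<C>" "v \<in> Obj \<C>" "w \<in> Obj \<C>"
  then show "obj_ten (obj_ten u v) w = obj_ten u (obj_ten v w)"
    by (simp add: Obj_iff m_assoc mu_T_mu[THEN mult_eq_assoc] mu_TT[THEN mult_eq_assoc])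
next
  fix u1 v1 w1 u2 v2 w2 s s' t t'
  assume "u1 \<in> Obj \<C>" "v1 \<in> Obj \<C>" "w1 \<in> Obj \<C>" "u2 \<in> Obj \<C>" "v2 \<in> Obj \<C>" "w2 \<in> Obj \<C>"
    "s \<in> Hom \<C> u1 v1" "s' \<in> Hom \<C> v1 w1" "t \<in> Hom \<C> u2 v2" "t' \<in> Hom \<C> v2 w2"
  then show "arr_ten u1 w1 u2 w2 (Comp \<C> u1 v1 w1 s' s) (Comp \<C> u2 v2 w2 t' t)
      = Comp \<C> (obj_ten u1 u2) (obj_ten v1 v2) (obj_ten w1 w2)
          (arr_ten v1 w1 v2 w2 s' t') (arr_ten u1 v1 u2 v2 s t)"
    unfolding Comp_eq by (intro arr_ten_comp) (auto simp: Obj_iff Hom_iff)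
next
  fix u1 v1 u2 v2 u3 v3 r s t
  assume "u1 \<in> Obj \<C>" "u2 \<in> Obj \<C>" "r \<in> Hom \<C> u1 v1" "s \<in> Hom \<C> u2 v2" "t \<in> Hom \<C> u3 v3"
  then show "arr_ten (obj_ten u1 u2) (obj_ten v1 v2) u3 v3 (arr_ten u1 v1 u2 v2 r s) t
      = arr_ten u1 v1 (obj_ten u2 u3) (obj_ten v2 v3) r (arr_ten u2 v2 u3 v3 s t)"
    by (intro arr_ten_assoc) (auto simp: Obj_iff Hom_iff)
next
  fix u v
  assume "u \<in> Obj \<C>" "v \<in> Obj \<C>"
  then show "obj_ten u v \<in> Obj \<C>" by (rule object_ten)
qed (simp_all add: object_eta arr_ten_closed, auto simp: Obj_iff Hom_iff rules)

section \<open>The monoid on \<delta> and cogeneration\<close>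

lemma monoid_delta: "monoid_object \<C> obj_ten arr_ten \<eta> \<delta> \<mu> \<eta>"
proof (intro monoid_object.intro monoid_object_axioms.intro strict_monoidal object_delta)
  show "\<mu> \<in> Hom \<C> (obj_ten \<delta> \<delta>) \<delta>"
    using Q_mu_gamma_T_delta by (simp add: Hom_iff m_assoc mu_T_delta_arrow)
  show "\<eta> \<in> Hom \<C> \<eta> \<delta>"
    by (simp add: Hom_iff Q_eta_eta)
  \<comment> \<open>By this counit condition the tensor of \<mu> with the identity is \<mu> itself,
    while that of the identity with \<mu> is \<open>T \<mu>\<close>; associativity becomes
    \<open>mu_T_mu\<close>.\<close>
  have "\<epsilon> \<otimes> obj_ten \<delta> \<delta> = \<one>"
    using object_ten[OF object_delta object_delta] by (simp add: Obj_iff)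
  then show "Comp \<C> (obj_ten (obj_ten \<delta> \<delta>) \<delta>) (obj_ten \<delta> \<delta>) \<delta> \<mu>
      (arr_ten (obj_ten \<delta> \<delta>) \<delta> \<delta> \<delta> \<mu> (Ident \<C> \<delta>))
    = Comp \<C> (obj_ten \<delta> (obj_ten \<delta> \<delta>)) (obj_ten \<delta> \<delta>) \<delta> \<mu>
      (arr_ten \<delta> \<delta> (obj_ten \<delta> \<delta>) \<delta> (Ident \<C> \<delta>) \<mu>)"
    by (simp add: m_assoc delta_T[symmetric] eps_delta[THEN mult_eq_assoc] mu_T_mu)
qed (simp_all add: m_assoc delta_T[symmetric] cancels cancels[THEN mult_eq_assoc])

text \<open>The separating arrow is \<open>v\<close> itself: the comodule law makes it an arrow to
  \<delta>, and \<epsilon> is a left inverse of it.\<close>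

lemma cogenerator_delta: "cogenerator \<C> \<delta>"
  unfolding cogenerator_def
proof (intro conjI ballI impI object_delta)
  fix u v s t
  assume v: "v \<in> Obj \<C>" and st: "s \<in> Hom \<C> u v" "t \<in> Hom \<C> u v" "s \<noteq> t"
  have "v \<in> Hom \<C> v \<delta>"
    using v by (simp add: Obj_iff Hom_iff)
  moreover have "v \<otimes> s \<noteq> v \<otimes> t"
    using v st unfolding Obj_iff Hom_iff by (metis eps_closed l_one m_assoc)
  ultimately show "\<exists>f\<in>Hom \<C> v \<delta>. Comp \<C> u v \<delta> f s \<noteq> Comp \<C> u v \<delta> f t"
    by auto
qed


section \<open>The endomorphism bialgebroid of \<open>\<delta>\<close>\<close>

abbreviation "\<F> \<equiv> endomorphism_monoid \<C> \<delta>"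
abbreviation "\<B> \<equiv> bialgebroid_biset \<F> Q target"

lemma carrier_F_iff: "f \<in> carrier \<F> \<longleftrightarrow> f \<in> carrier A \<and> Q f \<otimes> \<delta> = \<delta> \<otimes> f"
  and mult_F [simp]: "f \<otimes>\<^bsub>\<F>\<^esub> g = f \<otimes> g"
  and one_F [simp]: "\<one>\<^bsub>\<F>\<^esub> = \<one>"
  by (simp_all add: endomorphism_monoid_def Hom_iff)

lemma biset_F_simps [simp]:
  "elts \<B> = carrier \<F>" "lact \<B> a f = Q a \<otimes> f" "ract \<B> f a = target a \<otimes> f"
  by (simp_all add: bialgebroid_biset_def)

lemma F_closed: "f \<in> carrier \<F> \<Longrightarrow> f \<in> carrier A"
  by (simp add: carrier_F_iff)

lemma Q_delta_in_F: "a \<in> carrier A \<Longrightarrow> Q a \<otimes> \<delta> \<in> carrier \<F>"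
  by (simp add: carrier_F_iff m_assoc Q_delta_delta delta_Q[THEN mult_eq_assoc])

text \<open>The arrow law moves \<delta> to the left of \<open>f\<close>, where
  \<open>Q \<epsilon>\<close> cancels it. Hence \<open>\<epsilon> \<otimes> f\<close> is the
  coordinate of \<open>f\<close> under the bijection of \<open>\<F>\<close> with
  \<open>A\<close>.\<close>

lemma F_decomp: "f \<in> carrier \<F> \<Longrightarrow> Q (\<epsilon> \<otimes> f) \<otimes> \<delta> = f"
  by (simp add: carrier_F_iff m_assoc Q_eps_delta[THEN mult_eq_assoc])

lemma carrier_F: "carrier \<F> = {Q a \<otimes> \<delta> | a. a \<in> carrier A}"
proof (intro subset_antisym subsetI)
  fix f assume "f \<in> carrier \<F>"
  then have "f = Q (\<epsilon> \<otimes> f) \<otimes> \<delta>" "\<epsilon> \<otimes> f \<in> carrier A"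
    by (simp_all only: F_decomp F_closed eps_closed m_closed)
  then show "f \<in> {Q a \<otimes> \<delta> | a. a \<in> carrier A}"
    by blast
qed (auto simp: Q_delta_in_F)

lemma F_cases [elim?]:
  assumes "f \<in> carrier \<F>"
  obtains a where "a \<in> carrier A" "f = Q a \<otimes> \<delta>"
  using assms carrier_F by auto

lemma monoid_F: "Group.monoid \<F>"
proof (rule monoidI)
  fix f g assume "f \<in> carrier \<F>" "g \<in> carrier \<F>"
  then show "f \<otimes>\<^bsub>\<F>\<^esub> g \<in> carrier \<F>"
    unfolding carrier_F_iff mult_F by (metis m_assoc m_closed Q_closed Q_mult delta_closed)
qed (auto simp: carrier_F_iff m_assoc)

lemma Q_in_F: "a \<in> carrier A \<Longrightarrow> Q a \<in> carrier \<F>"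
  by (simp add: carrier_F_iff delta_Q)

lemma delta_in_F: "\<delta> \<in> carrier \<F>"
  by (simp add: carrier_F_iff Q_delta_delta)

lemma mult_in_F: "f \<in> carrier \<F> \<Longrightarrow> g \<in> carrier \<F> \<Longrightarrow> f \<otimes> g \<in> carrier \<F>"
  using monoid.m_closed[OF monoid_F] by simp

section \<open>The target map and the right action\<close>

lemma target_in_F:
  assumes a: "a \<in> carrier A"
  shows "target a \<in> carrier \<F>"
proof -
  have "Q (target a) \<otimes> \<delta> = Q \<mu> \<otimes> (\<gamma> \<otimes> (T (Q (Q a)) \<otimes> T (Q \<eta> \<otimes> \<eta>)))"
    using a by (simp add: target_def delta_def m_assoc gamma_TQ[symmetric]
        gamma_TQ[symmetric, THEN mult_eq_assoc])
  \<comment> \<open>\<open>Q_eta_eta\<close> brings in a \<delta>, which \<open>delta_Q\<close> then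
    moves to the left so that \<open>Q_mu_gamma_T_delta\<close> applies.\<close>
  also have "\<dots> = Q \<mu> \<otimes> (\<gamma> \<otimes> T ((Q (Q a) \<otimes> \<delta>) \<otimes> \<eta>))"
    unfolding Q_eta_eta using a by (simp add: m_assoc)
  also have "\<dots> = (Q \<mu> \<otimes> (\<gamma> \<otimes> T \<delta>)) \<otimes> T (Q a \<otimes> \<eta>)"
    unfolding delta_Q[OF a, symmetric] using a by (simp add: m_assoc)
  also have "\<dots> = \<delta> \<otimes> target a"
    unfolding Q_mu_gamma_T_delta using a by (simp add: target_def m_assoc)
  finally show ?thesis
    using a by (simp add: carrier_F_iff)
qed

lemma target_mult:
  assumes "a \<in> carrier A" "b \<in> carrier A"
  shows "target (b \<otimes> a) = target a \<otimes> target b"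
proof -
  have "target a \<otimes> target b = \<mu> \<otimes> (T (Q a) \<otimes> (T \<eta> \<otimes> (\<mu> \<otimes> (T (Q b) \<otimes> T \<eta>))))"
    using assms by (simp add: target_def m_assoc)
  also have "\<dots> = (\<mu> \<otimes> \<mu>) \<otimes> T (T (Q a) \<otimes> (T \<eta> \<otimes> (Q b \<otimes> \<eta>)))"
    using assms by (simp add: m_assoc mu_TT[symmetric] mu_TT[symmetric, THEN mult_eq_assoc])
  \<comment> \<open>Naturality of \<eta> carries \<open>Q b\<close> in front of \<open>Q a\<close>:
    the source of the order reversal.\<close>
  also have "T (Q a) \<otimes> (T \<eta> \<otimes> (Q b \<otimes> \<eta>)) = Q b \<otimes> (\<eta> \<otimes> (Q a \<otimes> \<eta>))"
    using assms by (simp add: rules)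
  also have "(\<mu> \<otimes> \<mu>) \<otimes> T (Q b \<otimes> (\<eta> \<otimes> (Q a \<otimes> \<eta>))) = \<mu> \<otimes> T (\<mu> \<otimes> (Q b \<otimes> (\<eta> \<otimes> (Q a \<otimes> \<eta>))))"
    using assms by (simp add: m_assoc mu_T_mu[THEN mult_eq_assoc])
  also have "\<mu> \<otimes> (Q b \<otimes> (\<eta> \<otimes> (Q a \<otimes> \<eta>))) = Q (b \<otimes> a) \<otimes> \<eta>"
    using assms by (simp add: m_assoc mu_Q[THEN mult_eq_assoc] mu_eta[THEN mult_eq_assoc])
  finally show ?thesis
    by (simp add: target_def)
qed

lemma Q_target_commute: "a \<in> carrier A \<Longrightarrow> b \<in> carrier A \<Longrightarrow> target b \<otimes> Q a = Q a \<otimes> target b"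
  by (simp add: target_def m_assoc T_Q_commute T_Q_commute[THEN mult_eq_assoc]
      mu_Q[THEN mult_eq_assoc])

lemma target_delta: "a \<in> carrier A \<Longrightarrow> target a \<otimes> \<delta> = Q (T a) \<otimes> \<delta>"
proof -
  assume a: "a \<in> carrier A"
  then have "target a \<otimes> \<delta> = (\<mu> \<otimes> \<delta>) \<otimes> (T (Q a) \<otimes> T \<eta>)"
    by (simp add: target_def m_assoc delta_T delta_T[THEN mult_eq_assoc])
  also have "\<dots> = Q (T a) \<otimes> \<delta>"
    unfolding mu_delta using a by (simp add: delta_def m_assoc gamma_TQ[THEN mult_eq_assoc])
  finally show ?thesis .
qed

lemma target_eta: "a \<in> carrier A \<Longrightarrow> target a \<otimes> \<eta> = Q a \<otimes> \<eta>"
  by (simp add: target_def rules)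

lemma eps_Q_delta: "a \<in> carrier A \<Longrightarrow> x \<in> carrier A \<Longrightarrow> \<epsilon> \<otimes> (Q a \<otimes> (\<delta> \<otimes> x)) = a \<otimes> x"
  and eps_Q_delta': "a \<in> carrier A \<Longrightarrow> \<epsilon> \<otimes> (Q a \<otimes> \<delta>) = a"
  by (simp_all add: rules)

text \<open>The target commutes with images of \<open>Q\<close>, so in
  \<open>Q b \<otimes> \<delta>\<close> it acts on \<delta> alone, where \<open>target_delta\<close>
  gives \<open>Q (T a)\<close>. In coordinates the right action is right multiplication by
  \<open>T a\<close>.\<close>

lemma eps_target:
  assumes "a \<in> carrier A" "f \<in> carrier \<F>"
  shows "\<epsilon> \<otimes> (target a \<otimes> f) = \<epsilon> \<otimes> f \<otimes> T a"
proof -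
  obtain b where b: "b \<in> carrier A" "f = Q b \<otimes> \<delta>"
    using assms F_cases by blast
  then have "target a \<otimes> f = Q (b \<otimes> T a) \<otimes> \<delta>"
    using assms(1) by (simp add: m_assoc Q_target_commute[THEN mult_eq_assoc] target_delta)
  then show ?thesis
    using b assms(1) eps_Q_delta'[of "b \<otimes> T a"] eps_Q_delta'[of b] by (simp add: m_assoc)
qed

lemma is_biset_F: "is_biset A \<B>"
  unfolding is_biset_def
  by (auto simp: mult_in_F Q_in_F target_in_F F_closed m_assoc target_mult
      Q_target_commute[THEN mult_eq_assoc]) (simp add: target_def mu_T_eta F_closed)+

text \<open>The identification of the tensor square of \<open>\<B>\<close> with \<open>A\<close>.\<close>

definition flat where "flat x y = \<epsilon> \<otimes> x \<otimes> T (\<epsilon> \<otimes> y)"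

lemma equiv_balancing_closure:
  fixes X :: "('a, 'x) biset" and Y :: "('a, 'y) biset"
  shows "equiv UNIV ((balancing A X Y \<union> (balancing A X Y)\<inverse>)\<^sup>*)"
  by (intro equivI) (auto simp: refl_on_def sym_Un_converse intro: sym_rtrancl trans_rtrancl)

lemma tensor_elt_self: "(x, y) \<in> tensor_elt A X Y x y"
  by (simp add: tensor_elt_def)

lemma tensor_elt_eqI:
  "(x', y') \<in> tensor_elt A X Y x y \<Longrightarrow> tensor_elt A X Y x' y' = tensor_elt A X Y x y"
  using equiv_class_eq[OF equiv_balancing_closure] by (fastforce simp: tensor_elt_def)

lemma tensor_elt_balanced:
  assumes "x \<in> elts X" "a \<in> carrier A" "y \<in> elts Y"
  shows "tensor_elt A X Y (ract X x a) y = tensor_elt A X Y x (lact Y a y)"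
proof (rule tensor_elt_eqI)
  have "((ract X x a, y), (x, lact Y a y)) \<in> balancing A X Y"
    using assms by (auto simp: balancing_def)
  then show "(ract X x a, y) \<in> tensor_elt A X Y x (lact Y a y)"
    unfolding tensor_elt_def by blast
qed

lemma flat_closed [simp]: "x \<in> carrier \<F> \<Longrightarrow> y \<in> carrier \<F> \<Longrightarrow> flat x y \<in> carrier A"
  by (simp add: flat_def F_closed)

text \<open>A scalar acting on the second factor moves into the coordinate of the first.
  \<open>Y\<close> is arbitrary so that in coassociativity the second factor can be the tensor
  square.\<close>

lemma tensor_F_canonical:
  assumes "x \<in> carrier \<F>" "y \<in> elts Y" "a \<in> carrier A"
  shows "tensor_elt A \<B> Y x (lact Y a y) = tensor_elt A \<B> Y (Q (\<epsilon> \<otimes> x \<otimes> T a) \<otimes> \<delta>) y"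
proof -
  have "target a \<otimes> x = Q (\<epsilon> \<otimes> x \<otimes> T a) \<otimes> \<delta>"
    using F_decomp[of "target a \<otimes> x"] assms by (simp add: mult_in_F target_in_F eps_target F_closed)
  then show ?thesis
    using tensor_elt_balanced[of x \<B> a y Y] assms by simp
qed

lemma tensor_F_canonical':
  assumes "x \<in> carrier \<F>" "y \<in> carrier \<F>"
  shows "tensor_elt A \<B> \<B> x y = tensor_elt A \<B> \<B> (Q (flat x y) \<otimes> \<delta>) \<delta>"
  using tensor_F_canonical[of x \<delta> \<B> "\<epsilon> \<otimes> y"] assms F_decomp[of y] F_closed delta_in_F
  by (simp add: flat_def)

text \<open>\<open>flat\<close> is constant along balancing steps, and by
  \<open>tensor_F_canonical'\<close> a class depends only on its value. Equality of tensors thus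
  becomes an equation in \<open>A\<close>.\<close>

lemma tensor_F_eq:
  assumes "x \<in> carrier \<F>" "y \<in> carrier \<F>"
  shows "tensor_elt A \<B> \<B> x y = {(x', y'). x' \<in> carrier \<F> \<and> y' \<in> carrier \<F> \<and> flat x' y' = flat x y}"
    (is "?L = ?R")
proof
  show "?L \<subseteq> ?R"
  proof
    fix p assume "p \<in> ?L"
    then have "((x, y), p) \<in> (balancing A \<B> \<B> \<union> (balancing A \<B> \<B>)\<inverse>)\<^sup>*"
      by (simp add: tensor_elt_def)
    then show "p \<in> ?R"
    proof (induction rule: rtrancl_induct)
      case base
      then show ?case using assms by simp
    next
      case (step p q)
      \<comment> \<open>Invariance under one generating step: both sides are \<open>\<epsilon>
        \<otimes> x \<otimes> T a \<otimes> T (\<epsilon> \<otimes> y)\<close>.\<close>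
      have "flat (target a \<otimes> x) y = flat x (Q a \<otimes> y)"
        if "x \<in> carrier \<F>" "a \<in> carrier A" "y \<in> carrier \<F>" for x a y
        using that by (simp add: flat_def eps_target F_closed m_assoc
            eps_nat[symmetric, THEN mult_eq_assoc])
      then show ?case
        using step by (auto simp: balancing_def mult_in_F Q_in_F target_in_F)
    qed
  qed
  show "?R \<subseteq> ?L"
    using assms tensor_F_canonical' tensor_elt_self by fastforce
qed

lemma tensor_F_cong:
  assumes "x \<in> carrier \<F>" "y \<in> carrier \<F>" "x' \<in> carrier \<F>" "y' \<in> carrier \<F>" "flat x y = flat x' y'"
  shows "tensor_elt A \<B> \<B> x y = tensor_elt A \<B> \<B> x' y'"
  using assms by (simp add: tensor_F_eq)

section \<open>Comultiplication and counit as maps of bisets\<close>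

definition comult where "comult f = tensor_elt A \<B> \<B> (Q (\<epsilon> \<otimes> f \<otimes> \<mu>) \<otimes> \<delta>) \<delta>"
definition counit where "counit f = \<epsilon> \<otimes> f \<otimes> \<eta>"

lemma flat_delta: "a \<in> carrier A \<Longrightarrow> flat (Q a \<otimes> \<delta>) \<delta> = a"
  by (simp add: flat_def eps_Q_delta' eps_delta)

text \<open>Replaces Sweedler notation: the equation for \<open>flat x y\<close> is all that later
  arguments use about a representative, besides membership in \<open>\<F>\<close>.\<close>

lemma comult_eq:
  assumes "f \<in> carrier \<F>"
  shows "comult f = {(x, y). x \<in> carrier \<F> \<and> y \<in> carrier \<F> \<and> flat x y = \<epsilon> \<otimes> f \<otimes> \<mu>}"
  using assms unfolding comult_def
  by (subst tensor_F_eq)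
    (simp_all add: Q_delta_in_F delta_in_F F_closed flat_delta m_assoc del: Q_mult)

lemma comult_eqI:
  assumes "f \<in> carrier \<F>" "x \<in> carrier \<F>" "y \<in> carrier \<F>" "flat x y = \<epsilon> \<otimes> f \<otimes> \<mu>"
  shows "comult f = tensor_elt A \<B> \<B> x y"
  using assms by (simp add: comult_eq tensor_F_eq)

text \<open>The action is a union over all representatives. Since \<open>flat\<close> gets
  multiplied by \<open>a\<close> on the left, all of them yield one class, and the union over a
  nonempty class is that class.\<close>

lemma lact_tensor_F:
  assumes "x \<in> carrier \<F>" "y \<in> carrier \<F>" "a \<in> carrier A"
  shows "lact (tensor_biset A \<B> \<B>) a (tensor_elt A \<B> \<B> x y) = tensor_elt A \<B> \<B> (Q a \<otimes> x) y"
proof -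
  have const: "tensor_elt A \<B> \<B> (Q a \<otimes> x') y' = tensor_elt A \<B> \<B> (Q a \<otimes> x) y"
    if "(x', y') \<in> tensor_elt A \<B> \<B> x y" for x' y'
  proof (rule tensor_F_cong)
    have xy: "x' \<in> carrier \<F>" "y' \<in> carrier \<F>" "flat x' y' = flat x y"
      using that assms by (auto simp: tensor_F_eq)
    have "flat (Q a \<otimes> z) w = a \<otimes> flat z w" if "z \<in> carrier \<F>" "w \<in> carrier \<F>" for z w
      using that assms by (simp add: flat_def F_closed m_assoc
            eps_nat[symmetric, THEN mult_eq_assoc])
    then show "flat (Q a \<otimes> x') y' = flat (Q a \<otimes> x) y"
      using assms xy by simp
  qed (use that assms in \<open>auto simp: tensor_F_eq mult_in_F Q_in_F\<close>)
  have "(\<Union>(x', y')\<in>tensor_elt A \<B> \<B> x y. tensor_elt A \<B> \<B> (Q a \<otimes> x') y')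
      = tensor_elt A \<B> \<B> (Q a \<otimes> x) y"
  proof (rule SUP_eq_const)
    show "tensor_elt A \<B> \<B> x y \<noteq> {}"
      using tensor_elt_self[of x y \<B> \<B>] by blast
  qed (clarsimp simp only: prod.case const)
  then show ?thesis
    by (simp add: tensor_biset_def)
qed

text \<open>As for the left action; here \<open>flat\<close> gets multiplied by
  \<open>T (T a)\<close> on the right.\<close>

lemma ract_tensor_F:
  assumes "x \<in> carrier \<F>" "y \<in> carrier \<F>" "a \<in> carrier A"
  shows "ract (tensor_biset A \<B> \<B>) (tensor_elt A \<B> \<B> x y) a = tensor_elt A \<B> \<B> x (target a \<otimes> y)"
proof -
  have const: "tensor_elt A \<B> \<B> x' (target a \<otimes> y') = tensor_elt A \<B> \<B> x (target a \<otimes> y)"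
    if "(x', y') \<in> tensor_elt A \<B> \<B> x y" for x' y'
  proof (rule tensor_F_cong)
    have xy: "x' \<in> carrier \<F>" "y' \<in> carrier \<F>" "flat x' y' = flat x y"
      using that assms by (auto simp: tensor_F_eq)
    have "flat z (target a \<otimes> w) = flat z w \<otimes> T (T a)" if "z \<in> carrier \<F>" "w \<in> carrier \<F>" for z w
      using that assms by (simp add: flat_def F_closed m_assoc eps_target)
    then show "flat x' (target a \<otimes> y') = flat x (target a \<otimes> y)"
      using assms xy by simp
  qed (use that assms in \<open>auto simp: tensor_F_eq mult_in_F target_in_F\<close>)
  have "(\<Union>(x', y')\<in>tensor_elt A \<B> \<B> x y. tensor_elt A \<B> \<B> x' (target a \<otimes> y'))
      = tensor_elt A \<B> \<B> x (target a \<otimes> y)"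
  proof (rule SUP_eq_const)
    show "tensor_elt A \<B> \<B> x y \<noteq> {}"
      using tensor_elt_self[of x y \<B> \<B>] by blast
  qed (clarsimp simp only: prod.case const)
  then show ?thesis
    by (simp add: tensor_biset_def)
qed


lemma comult_biset_hom: "comult \<in> biset_hom A \<B> (tensor_biset A \<B> \<B>)"
  unfolding biset_hom_def
proof (intro CollectI conjI ballI)
  show "comult \<in> elts \<B> \<rightarrow> elts (tensor_biset A \<B> \<B>)"
    by (fastforce simp: comult_def tensor_biset_def F_closed
        simp del: Q_mult intro: Q_delta_in_F delta_in_F)
next
  fix a f
  assume a: "a \<in> carrier A" and "f \<in> elts \<B>"
  then have f: "f \<in> carrier \<F>" by simp
  define c where "c = \<epsilon> \<otimes> f \<otimes> \<mu>"
  have c: "c \<in> carrier A" and cf: "comult f = tensor_elt A \<B> \<B> (Q c \<otimes> \<delta>) \<delta>"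
    using f by (simp_all add: c_def F_closed comult_def)
  have "\<epsilon> \<otimes> (Q a \<otimes> f) \<otimes> \<mu> = a \<otimes> c"
    using a f by (simp add: F_closed c_def m_assoc eps_nat[symmetric, THEN mult_eq_assoc])
  then show "comult (lact \<B> a f) = lact (tensor_biset A \<B> \<B>) a (comult f)"
    unfolding cf using a c by (simp add: comult_def lact_tensor_F Q_delta_in_F delta_in_F m_assoc)
  \<comment> \<open>Right linearity is naturality of \<mu>: the left value of \<open>flat\<close> is
    \<open>c \<otimes> T (T a)\<close>, and \<open>mu_TT\<close> identifies it with the right
    one.\<close>
  have "comult (target a \<otimes> f) = tensor_elt A \<B> \<B> (Q c \<otimes> \<delta>) (target a \<otimes> \<delta>)"
  proof (rule comult_eqI)
    show "flat (Q c \<otimes> \<delta>) (target a \<otimes> \<delta>) = \<epsilon> \<otimes> (target a \<otimes> f) \<otimes> \<mu>"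
      unfolding eps_target[OF a f] flat_def eps_target[OF a delta_in_F] eps_Q_delta'[OF c]
      using a f by (simp add: eps_delta mu_TT m_assoc F_closed c_def)
  qed (use a f c in \<open>simp_all add: mult_in_F target_in_F Q_delta_in_F delta_in_F\<close>)
  then show "comult (ract \<B> f a) = ract (tensor_biset A \<B> \<B>) (comult f) a"
    unfolding cf using a c by (simp add: ract_tensor_F Q_delta_in_F delta_in_F)
qed

lemma counit_biset_hom: "counit \<in> biset_hom A \<B> (regular_biset A)"
  by (auto simp: biset_hom_def regular_biset_def counit_def F_closed eps_target m_assoc
      eps_nat[symmetric, THEN mult_eq_assoc] eta_nat)

lemma comult_repr:
  assumes "f \<in> carrier \<F>" "(x, y) \<in> comult f"
  shows "x \<in> carrier \<F>" "y \<in> carrier \<F>" "flat x y = \<epsilon> \<otimes> f \<otimes> \<mu>"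
  using assms by (auto simp: comult_eq)

section \<open>The comonoid laws\<close>

lemma coassociative:
  assumes f: "f \<in> carrier \<F>" and xy: "(x, y) \<in> comult f" and x12: "(x1, x2) \<in> comult x"
  shows "tensor_elt A \<B> (tensor_biset A \<B> \<B>) x1 (tensor_elt A \<B> \<B> x2 y)
    = tensor_elt A \<B> (tensor_biset A \<B> \<B>) x (comult y)"
proof -
  let ?BB = "tensor_biset A \<B> \<B>" and ?dd = "tensor_elt A \<B> \<B> \<delta> \<delta>"
  note x = comult_repr[OF f xy]
  note x' = comult_repr[OF x(1) x12]
  have dd: "?dd \<in> elts ?BB"
    using delta_in_F by (auto simp: tensor_biset_def)
  \<comment> \<open>Both second factors are scalars acting on the base point \<open>?dd\<close>, so
    \<open>tensor_F_canonical\<close> moves the scalars into the first factor and only coordinates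
    have to be compared.\<close>
  have "tensor_elt A \<B> \<B> x2 y = lact ?BB (flat x2 y) ?dd"
    "comult y = lact ?BB (\<epsilon> \<otimes> y \<otimes> \<mu>) ?dd"
    using tensor_F_canonical'[OF x'(2) x(2)] x x' delta_in_F
    by (simp_all add: lact_tensor_F comult_def F_closed)
  \<comment> \<open>The two sides reduce to
    \<open>\<epsilon> \<otimes> f \<otimes> \<mu> \<otimes> \<mu>\<close> and
    \<open>\<epsilon> \<otimes> f \<otimes> \<mu> \<otimes> T \<mu>\<close>, equal by associativity
    of the monad.\<close>
  moreover have "\<epsilon> \<otimes> x1 \<otimes> T (flat x2 y) = \<epsilon> \<otimes> x \<otimes> T (\<epsilon> \<otimes> y \<otimes> \<mu>)"
  proof -
    have car: "f \<in> carrier A" "x \<in> carrier A" "y \<in> carrier A" "x1 \<in> carrier A" "x2 \<in> carrier A"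
      using f x x' F_closed by auto
    have "\<epsilon> \<otimes> x1 \<otimes> T (flat x2 y) = flat x1 x2 \<otimes> T (T (\<epsilon> \<otimes> y))"
      using car by (simp add: flat_def m_assoc)
    also have "\<dots> = flat x y \<otimes> \<mu>"
      unfolding x'(3) using car by (simp add: flat_def m_assoc mu_TT mu_TT[THEN mult_eq_assoc])
    also have "\<dots> = flat x y \<otimes> T \<mu>"
      unfolding x(3) using car by (simp add: m_assoc mu_T_mu)
    finally show ?thesis
      using car by (simp add: flat_def m_assoc)
  qed
  ultimately show ?thesis
    using tensor_F_canonical[OF x'(1) dd, of "flat x2 y"]
      tensor_F_canonical[OF x(1) dd, of "\<epsilon> \<otimes> y \<otimes> \<mu>"] x x'
    by (simp add: F_closed del: Q_mult T_mult)
qed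

text \<open>The coordinates of the two left sides are \<open>flat x y\<close> times \<eta> and times
  \<open>T \<eta>\<close>; as \<open>flat x y\<close> ends in \<mu>, the unit laws of the monad
  apply.\<close>

lemma counital:
  assumes f: "f \<in> carrier \<F>" and xy: "(x, y) \<in> comult f"
  shows "Q (counit x) \<otimes> y = f" "target (counit y) \<otimes> x = f"
proof -
  note x = comult_repr[OF f xy]
  have car: "f \<in> carrier A" "x \<in> carrier A" "y \<in> carrier A"
    using f x F_closed by auto
  have ceta: "\<epsilon> \<otimes> (Q (counit x) \<otimes> y) = flat x y \<otimes> \<eta>"
    using car by (simp add: counit_def flat_def m_assoc eps_nat[symmetric, THEN mult_eq_assoc]
        eta_nat eta_nat[THEN mult_eq_assoc])
  have "counit y \<in> carrier A"
    using car by (simp add: counit_def)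
  from eps_target[OF this x(1)]
  have "\<epsilon> \<otimes> (target (counit y) \<otimes> x) = flat x y \<otimes> T \<eta>"
    using car by (simp add: counit_def flat_def m_assoc)
  then have "\<epsilon> \<otimes> (target (counit y) \<otimes> x) = \<epsilon> \<otimes> f" "\<epsilon> \<otimes> (Q (counit x) \<otimes> y) = \<epsilon> \<otimes> f"
    unfolding ceta x(3) using car by (simp_all add: m_assoc mu_eta mu_T_eta)
  moreover have "g = f" if "g \<in> carrier \<F>" "\<epsilon> \<otimes> g = \<epsilon> \<otimes> f" for g
    using that f F_decomp by metis
  moreover have "Q (counit x) \<otimes> y \<in> carrier \<F>" "target (counit y) \<otimes> x \<in> carrier \<F>"
    using x car by (simp_all add: mult_in_F Q_in_F target_in_F counit_def del: Q_mult)
  ultimately show "Q (counit x) \<otimes> y = f" "target (counit y) \<otimes> x = f"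
    by blast+
qed

lemma comonoid_F: "biset_comonoid A \<B> comult counit"
  unfolding biset_comonoid_def
  using is_biset_F comult_biset_hom counit_biset_hom coassociative counital by auto

section \<open>Compatibility with the multiplication\<close>

lemma takeuchi_F:
  assumes a: "a \<in> carrier A" and f: "f \<in> carrier \<F>" and xy: "(x, y) \<in> comult f"
  shows "tensor_elt A \<B> \<B> (x \<otimes> target a) y = tensor_elt A \<B> \<B> x (y \<otimes> Q a)"
proof (rule tensor_F_cong)
  note x = comult_repr[OF f xy]
  have car: "f \<in> carrier A" "x \<in> carrier A" "y \<in> carrier A"
    using f x F_closed by auto
  have "flat (x \<otimes> target a) y = \<epsilon> \<otimes> (x \<otimes> (\<mu> \<otimes> T (Q a \<otimes> (\<eta> \<otimes> (\<epsilon> \<otimes> y)))))"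
    using a car by (simp add: flat_def target_def m_assoc)
  \<comment> \<open>Naturality of \<eta> moves the coordinate of \<open>y\<close> to the left, where
    it can pass \<mu> and join \<open>x\<close> to form \<open>flat x y\<close>.\<close>
  also have "Q a \<otimes> (\<eta> \<otimes> (\<epsilon> \<otimes> y)) = T (\<epsilon> \<otimes> y) \<otimes> (Q a \<otimes> \<eta>)"
    using a car by (simp add: rules)
  also have "\<epsilon> \<otimes> (x \<otimes> (\<mu> \<otimes> T (T (\<epsilon> \<otimes> y) \<otimes> (Q a \<otimes> \<eta>))))
      = \<epsilon> \<otimes> (x \<otimes> (\<mu> \<otimes> (T (T (\<epsilon> \<otimes> y)) \<otimes> T (Q a \<otimes> \<eta>))))"
    using a car by simp
  also have "\<dots> = flat x y \<otimes> \<mu> \<otimes> T (Q a \<otimes> \<eta>)"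
    using a car by (simp add: flat_def m_assoc mu_TT mu_TT[THEN mult_eq_assoc])
  \<comment> \<open>The representative equation supplies a second \<mu>, and associativity of the
    monad pushes one of the two under \<open>T\<close>, where it cancels \<eta>.\<close>
  also have "\<dots> = \<epsilon> \<otimes> f \<otimes> \<mu> \<otimes> T (\<mu> \<otimes> (Q a \<otimes> \<eta>))"
    unfolding x(3) using a car by (simp add: m_assoc mu_T_mu[THEN mult_eq_assoc])
  also have "\<mu> \<otimes> (Q a \<otimes> \<eta>) = Q a"
    using a by (simp add: rules)
  also have "\<epsilon> \<otimes> f \<otimes> \<mu> \<otimes> T (Q a) = flat x (y \<otimes> Q a)"
    unfolding x(3)[symmetric] using a car by (simp add: flat_def m_assoc)
  finally show "flat (x \<otimes> target a) y = flat x (y \<otimes> Q a)" .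
qed (use comult_repr[OF f xy] a in \<open>auto simp: mult_in_F Q_in_F target_in_F\<close>)

lemma comult_mult_F:
  assumes f: "f \<in> carrier \<F>" and f': "f' \<in> carrier \<F>"
    and xy: "(x, y) \<in> comult f" and xy': "(x', y') \<in> comult f'"
  shows "comult (f \<otimes> f') = tensor_elt A \<B> \<B> (x \<otimes> x') (y \<otimes> y')"
proof (rule comult_eqI)
  note x = comult_repr[OF f xy] and x' = comult_repr[OF f' xy']
  obtain c where c: "c \<in> carrier A" "y = Q c \<otimes> \<delta>" using x F_cases by blast
  obtain b' where b': "b' \<in> carrier A" "x' = Q b' \<otimes> \<delta>" using x' F_cases by blast
  obtain c' where c': "c' \<in> carrier A" "y' = Q c' \<otimes> \<delta>" using x' F_cases by blast
  obtain a' where a': "a' \<in> carrier A" "f' = Q a' \<otimes> \<delta>" using f' F_cases by blast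
  have car: "f \<in> carrier A" "x \<in> carrier A"
    using f x F_closed by auto
  have fl: "\<epsilon> \<otimes> (x \<otimes> T c) = \<epsilon> \<otimes> (f \<otimes> \<mu>)"
    using x(3) c car eps_Q_delta' by (simp add: flat_def m_assoc)
  have fl': "b' \<otimes> T c' = a' \<otimes> \<mu>"
    using x'(3) b' c' a' eps_Q_delta' eps_Q_delta by (simp add: flat_def m_assoc)
  have "\<epsilon> \<otimes> (y \<otimes> y') = c \<otimes> y'"
    using c c' eps_Q_delta[of c y'] by (simp add: m_assoc)
  then have "flat (x \<otimes> x') (y \<otimes> y') = \<epsilon> \<otimes> (x \<otimes> (Q b' \<otimes> (\<delta> \<otimes> (T c \<otimes> T y'))))"
    using car b' c c' by (simp add: flat_def m_assoc)
  \<comment> \<open>\<open>T c\<close> commutes with \<delta> and with \<open>Q b'\<close>, so it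
    reaches \<open>x\<close> and the equation for \<open>f\<close> can be used.\<close>
  also have "\<dots> = (\<epsilon> \<otimes> (x \<otimes> T c)) \<otimes> (Q b' \<otimes> (\<delta> \<otimes> T y'))"
    using car b' c c' by (simp add: m_assoc delta_T[THEN mult_eq_assoc]
        T_Q_commute[THEN mult_eq_assoc])
  also have "\<dots> = (\<epsilon> \<otimes> f) \<otimes> (Q b' \<otimes> (\<mu> \<otimes> (\<delta> \<otimes> T y')))"
    unfolding fl using car b' c c' by (simp add: m_assoc mu_Q[THEN mult_eq_assoc])
  \<comment> \<open>\<open>\<mu> \<otimes> \<delta>\<close> is \<gamma>, which turns
    \<open>T (Q c')\<close> into \<open>Q (T c')\<close>; this assembles the left side of
    \<open>fl'\<close> under \<open>Q\<close>.\<close>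
  also have "\<dots> = (\<epsilon> \<otimes> f) \<otimes> (Q (b' \<otimes> T c') \<otimes> (\<gamma> \<otimes> T \<delta>))"
    using car b' c' by (simp add: m_assoc mu_delta[THEN mult_eq_assoc] gamma_TQ[THEN mult_eq_assoc])
  also have "\<dots> = \<epsilon> \<otimes> (f \<otimes> f') \<otimes> \<mu>"
    unfolding fl' using car a' Q_mu_gamma_T_delta by (simp add: m_assoc)
  finally show "flat (x \<otimes> x') (y \<otimes> y') = \<epsilon> \<otimes> (f \<otimes> f') \<otimes> \<mu>" .
qed (use assms comult_repr[OF f xy] comult_repr[OF f' xy'] in \<open>auto simp: mult_in_F\<close>)

lemma one_in_F: "\<one> \<in> carrier \<F>"
  by (simp add: carrier_F_iff)

lemma comult_one_F: "comult \<one> = tensor_elt A \<B> \<B> \<one> \<one>"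
  by (rule comult_eqI) (simp_all add: one_in_F flat_def eps_mu)

text \<open>For \<open>f'\<close> with coordinate \<open>b\<close> the counit is
  \<open>b \<otimes> \<eta>\<close>, and \<open>Q_eta_eta\<close> turns the resulting
  \<open>Q \<eta> \<otimes> \<eta>\<close> into \<open>\<delta> \<otimes> \<eta>\<close>, restoring
  \<open>f'\<close>.\<close>

lemma counit_source_F:
  assumes "f \<in> carrier \<F>" "f' \<in> carrier \<F>"
  shows "counit (f \<otimes> Q (counit f')) = counit (f \<otimes> f')"
proof -
  obtain b where "b \<in> carrier A" "f' = Q b \<otimes> \<delta>" using assms F_cases by blast
  moreover have "counit f' = b \<otimes> \<eta>"
    using calculation eps_Q_delta[of b \<eta>] by (simp add: counit_def m_assoc)
  ultimately show ?thesis
    using assms by (simp add: counit_def F_closed m_assoc Q_eta_eta)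
qed

text \<open>Source and target agree in front of \<eta> by \<open>target_eta\<close>, which reduces
  the claim to \<open>counit_source_F\<close>.\<close>

lemma counit_target_F:
  assumes "f \<in> carrier \<F>" "f' \<in> carrier \<F>"
  shows "counit (f \<otimes> target (counit f')) = counit (f \<otimes> f')"
proof -
  have "counit f' \<in> carrier A"
    using assms by (simp add: counit_def F_closed)
  then have "counit (f \<otimes> target (counit f')) = counit (f \<otimes> Q (counit f'))"
    using assms by (simp add: counit_def[of "f \<otimes> _"] F_closed m_assoc target_eta)
  then show ?thesis
    using assms by (simp add: counit_source_F)
qed

lemma target_morphism: "target \<in> monoid_morphisms (opposite_monoid A) \<F>"
  by (simp add: monoid_morphisms_def hom_def opposite_monoid_def target_in_F target_mult)
    (simp add: target_def mu_T_eta)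

lemma bialgebroid_F: "left_bialgebroid A \<F> Q target comult counit"
proof (intro left_bialgebroid.intro left_bialgebroid_axioms.intro)
  show "Q \<in> monoid_morphisms A \<F>"
    by (simp add: monoid_morphisms_def hom_def Q_in_F)
  show "counit \<one>\<^bsub>\<F>\<^esub> = \<one>"
    by (simp add: counit_def eps_eta)
qed (simp_all add: monoid_axioms monoid_F target_morphism Q_target_commute comonoid_F takeuchi_F
    comult_mult_F comult_one_F counit_source_F counit_target_F)

lemma source_regular_F: "source_regular A \<F> Q"
  unfolding source_regular_def
proof (intro exI conjI ballI)
  show "bij_betw (\<lambda>a. Q a \<otimes> \<delta>) (carrier A) (carrier \<F>)"
    by (rule bij_betwI[where g = "\<lambda>f. \<epsilon> \<otimes> f"])
      (auto simp: Q_delta_in_F F_closed F_decomp eps_Q_delta' simp del: Q_mult)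
qed (simp add: m_assoc)

end


theorem proposition3p1:
  fixes A :: "('a, 'm) monoid_scheme" (structure)
    and T Q S :: "'a \<Rightarrow> 'a"
    and \<gamma> \<eta> \<epsilon> \<mu> \<delta> :: 'a
    and C :: "('a, 'a) cat"
    and ten :: "'a \<Rightarrow> 'a \<Rightarrow> 'a"
    and tenA :: "'a \<Rightarrow> 'a \<Rightarrow> 'a \<Rightarrow> 'a \<Rightarrow> 'a \<Rightarrow> 'a \<Rightarrow> 'a"
    and F :: "'a monoid"
    and B :: "('a, 'a) biset"
    and \<Delta>\<^sub>F :: "'a \<Rightarrow> ('a \<times> 'a) set"
    and \<epsilon>\<^sub>F :: "'a \<Rightarrow> 'a"
  assumes "skew_monoidal_monoid A T Q \<gamma> \<eta> \<epsilon>"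
    and "\<mu> = Q \<epsilon> \<otimes> \<gamma>"
    and "\<delta> = \<gamma> \<otimes> T \<eta>"
    and "S = (\<lambda>a. \<mu> \<otimes> T (Q a \<otimes> \<eta>))"
    and "C = comodule_category A Q \<delta> \<epsilon>"
    and "ten = (\<lambda>u v. \<mu> \<otimes> T v \<otimes> u)"
    and "tenA = (\<lambda>u1 v1 u2 v2 s t. s \<otimes> \<epsilon> \<otimes> T t \<otimes> u1)"
    and "F = endomorphism_monoid C \<delta>"
    and "B = \<lparr>elts = carrier F, lact = (\<lambda>a f. Q a \<otimes> f), ract = (\<lambda>f a. S a \<otimes> f)\<rparr>"
    and "\<Delta>\<^sub>F = (\<lambda>f. tensor_elt A B B (Q (\<epsilon> \<otimes> f \<otimes> \<mu>) \<otimes> \<delta>) \<delta>)"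
    and "\<epsilon>\<^sub>F = (\<lambda>f. \<epsilon> \<otimes> f \<otimes> \<eta>)"
  shows "strict_monoidal_category C ten tenA \<eta>
    \<and> monoid_object C ten tenA \<eta> \<delta> \<mu> \<eta>
    \<and> cogenerator C \<delta>
    \<and> carrier F = {Q a \<otimes> \<delta> | a. a \<in> carrier A}
    \<and> left_bialgebroid A F Q S \<Delta>\<^sub>F \<epsilon>\<^sub>F
    \<and> source_regular A F Q
    \<and> \<Delta>\<^sub>F \<in> biset_hom A B (tensor_biset A B B)
    \<and> \<epsilon>\<^sub>F \<in> biset_hom A B (regular_biset A)"
proof -
  interpret skew_monoidal_monoid A T Q \<gamma> \<eta> \<epsilon>
    by fact
  \<comment> \<open>Identifies the variables \<mu> and \<delta> of the statement with the constants
    \<open>mu\<close> and \<open>delta\<close> of the locale.\<close>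
  note eqs = assms(2,3)[folded mu_def delta_def]
  have S: "S = target"
    unfolding assms(4) eqs by (simp add: target_def fun_eq_iff)
  have F: "F = endomorphism_monoid (comodule_category A Q delta \<epsilon>) delta"
    unfolding assms(8,5) eqs ..
  have B: "B = bialgebroid_biset F Q target"
    unfolding assms(9) S F by (simp add: bialgebroid_biset_def)
  have D: "\<Delta>\<^sub>F = comult" "\<epsilon>\<^sub>F = counit"
    unfolding assms(10,11) B F eqs by (simp_all add: comult_def counit_def fun_eq_iff)
  show ?thesis
    unfolding D B unfolding F S assms(5-7) eqs
    using strict_monoidal monoid_delta cogenerator_delta carrier_F bialgebroid_F source_regular_F
      comult_biset_hom counit_biset_hom by blast
qed

end
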